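(* Let $k$ be an algebraically closed field of characteristic zero, let $B$ be a finitely generated $k$-domain with field of fractions $K=\operatorname{Frac}(B)$, and let $D$ be a semisimple $k$-derivation of $B$ whose eigenvalues are all integers. Denote again by $D$ its unique extension to a derivation of $K$, and let $s\in K$, $s\neq 0$, be such that $D(s)=s$. Suppose that $K$ is generated as a field over $k$ by elements $b_1,\dots,b_n\in K$ satisfying $D(b_i)=\lambda_i b_i$ with $\lambda_i\in\mathbb{Z}$ for $i=1,\dots,n$. Then the kernel $\ker(D)=\{f\in K\mid D(f)=0\}$ of $D$ on $K$ is $$\ker(D)=k\left(b_1s^{-\lambda_1},\dots,b_ns^{-\lambda_n}\right),$$ and $$K=\ker(D)(s).$$
   Context: A $k$-derivation $D$ of $B$ is called semisimple if $B$ is the direct sum of the eigenspaces of $D$, i.e. $B=\bigoplus_{\lambda\in k}B_\lambda$ with $B_\lambda=\{b\in B\mid D(b)=\lambda b\}$; its eigenvalues are the $\lambda\in k$ with $B_\lambda\neq 0$. Since $k$ has characteristic zero, $\mathbb{Z}$ is regarded as a subset of $k$. The derivation $D$ extends uniquely to $K$ by the quotient rule. $k(u_1,\dots,u_n)$ denotes the subfield of $K$ generated over $k$ by $u_1,\dots,u_n$, and $\ker(D)(s)$ the subfield of $K$ generated by $\ker(D)$ and $s$. *)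

theory Defs
  imports "HOL-Computational_Algebra.Computational_Algebra"
begin

section \<open>Commutative algebras over a field\<close>

locale comm_algebra = vector_space scale
  for scale :: "'k::field \<Rightarrow> 'b::comm_ring_1 \<Rightarrow> 'b" +
  assumes scale_mult_left: "scale c (x * y) = scale c x * y"

definition is_subalgebra :: "('k::field \<Rightarrow> 'b::comm_ring_1 \<Rightarrow> 'b) \<Rightarrow> 'b set \<Rightarrow> bool"
  where "is_subalgebra scale S \<longleftrightarrow>
    module.subspace scale S \<and> 1 \<in> S \<and> (\<forall>x\<in>S. \<forall>y\<in>S. x * y \<in> S)"

definition fin_gen_algebra :: "('k::field \<Rightarrow> 'b::comm_ring_1 \<Rightarrow> 'b) \<Rightarrow> bool"
  where "fin_gen_algebra scale \<longleftrightarrow> (\<exists>S. finite S \<and> is_subalgebra scale hull S = UNIV)"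

section \<open>Derivations\<close>

definition derivation_over ::
    "('k::field \<Rightarrow> 'b::comm_ring_1 \<Rightarrow> 'b) \<Rightarrow> ('b \<Rightarrow> 'b) \<Rightarrow> bool"
  where "derivation_over scale D \<longleftrightarrow>
    Vector_Spaces.linear scale scale D \<and> (\<forall>x y. D (x * y) = D x * y + x * D y)"

definition eigenspace ::
    "('k::field \<Rightarrow> 'b::comm_ring_1 \<Rightarrow> 'b) \<Rightarrow> ('b \<Rightarrow> 'b) \<Rightarrow> 'k \<Rightarrow> 'b set"
  where "eigenspace scale D c = {b. D b = scale c b}"

definition eigenvalues ::
    "('k::field \<Rightarrow> 'b::comm_ring_1 \<Rightarrow> 'b) \<Rightarrow> ('b \<Rightarrow> 'b) \<Rightarrow> 'k set"
  where "eigenvalues scale D = {c. eigenspace scale D c \<noteq> {0}}"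

text \<open>The internal direct sum condition: every element is, in a unique way, the sum of a
  finitely supported family of components \<open>x c\<close> in the eigenspaces.\<close>

definition semisimple ::
    "('k::field \<Rightarrow> 'b::comm_ring_1 \<Rightarrow> 'b) \<Rightarrow> ('b \<Rightarrow> 'b) \<Rightarrow> bool"
  where "semisimple scale D \<longleftrightarrow>
    (\<forall>b. \<exists>!x :: 'k \<Rightarrow> 'b. (\<forall>c. x c \<in> eigenspace scale D c) \<and> finite {c. x c \<noteq> 0} \<and>
      b = (\<Sum>c | x c \<noteq> 0. x c))"

section \<open>The field of fractions\<close>

definition fract_scale :: "('k::field \<Rightarrow> 'b::idom \<Rightarrow> 'b) \<Rightarrow> 'k \<Rightarrow> 'b fract \<Rightarrow> 'b fract"
  where "fract_scale scale c x = to_fract (scale c 1) * x"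

definition base_field :: "('k::field \<Rightarrow> 'b::idom \<Rightarrow> 'b) \<Rightarrow> 'b fract set"
  where "base_field scale = range (\<lambda>c. to_fract (scale c 1))"

definition is_subfield :: "'f::field set \<Rightarrow> bool"
  where "is_subfield S \<longleftrightarrow> 0 \<in> S \<and> 1 \<in> S \<and>
    (\<forall>x\<in>S. \<forall>y\<in>S. x + y \<in> S \<and> x * y \<in> S) \<and> (\<forall>x\<in>S. - x \<in> S \<and> inverse x \<in> S)"

definition field_adjoin :: "'f::field set \<Rightarrow> 'f set \<Rightarrow> 'f set"
  where "field_adjoin F U = is_subfield hull (F \<union> U)"

text \<open>The quotient rule. For a derivation \<open>D\<close> the value does not depend on the chosen
  representation of the fraction (\<open>fract_deriv_Fract\<close>), and \<open>fract_deriv D\<close> is the only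
  derivation extending \<open>D\<close> (\<open>derivation_fract_deriv\<close>, \<open>fract_deriv_to_fract\<close>,
  \<open>fract_deriv_unique\<close>).\<close>

definition fract_deriv :: "('b::idom \<Rightarrow> 'b) \<Rightarrow> 'b fract \<Rightarrow> 'b fract"
  where "fract_deriv D q =
    (THE r. \<exists>a b. b \<noteq> 0 \<and> q = Fract a b \<and> r = Fract (D a * b - a * D b) (b * b))"

lemma derivation_overD:
  assumes "derivation_over scale D"
  shows "D (x + y) = D x + D y" "D (scale c x) = scale c (D x)"
    "D (x * y) = D x * y + x * D y"
proof -
  interpret Vector_Spaces.linear scale scale D
    using assms by (simp add: derivation_over_def)
  show "D (x + y) = D x + D y" "D (scale c x) = scale c (D x)"
    by (rule add, rule scale)
  show "D (x * y) = D x * y + x * D y"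
    using assms by (simp add: derivation_over_def)
qed

lemma derivation_over_1:
  assumes "derivation_over scale D"
  shows "D 1 = 0"
proof -
  have "D 1 + D 1 = D 1 + 0" using derivation_overD(3)[OF assms, of 1 1]
    by (simp only: mult_1_left mult_1_right add_0_right)
  thus ?thesis by (simp only: add_left_cancel)
qed

lemma fract_deriv_Fract:
  fixes D :: "'b::idom \<Rightarrow> 'b"
  assumes D: "derivation_over scale D" and b: "b \<noteq> 0"
  shows "fract_deriv D (Fract a b) = Fract (D a * b - a * D b) (b * b)"
proof -
  have "Fract (D a' * b' - a' * D b') (b' * b') = Fract (D a * b - a * D b) (b * b)"
    if b': "b' \<noteq> 0" and eq: "Fract a b = Fract a' b'" for a' b'
  proof -
    have ab: "a * b' = a' * b" using eq b b' by (simp add: eq_fract)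
    from arg_cong[OF ab, of D] have "D a * b' + a * D b' = D a' * b + a' * D b"
      by (simp add: derivation_overD(3)[OF D])
    hence *: "D a' * b = D a * b' + a * D b' - a' * D b" by (simp add: algebra_simps)
    have "(D a' * b' - a' * D b') * (b * b) = (D a' * b) * (b' * b) - (a' * b) * (b * D b')"
      by (simp add: algebra_simps)
    also have "\<dots> = (D a * b' + a * D b' - a' * D b) * (b' * b) - (a * b') * (b * D b')"
      by (simp only: * ab)
    also have "\<dots> = D a * b * (b' * b') - (a' * b) * D b * b'"
      by (simp add: algebra_simps)
    also have "\<dots> = (D a * b - a * D b) * (b' * b')"
      by (simp only: ab[symmetric]) (simp add: algebra_simps)
    finally show ?thesis using b b' by (simp add: eq_fract)
  qed
  then show ?thesis unfolding fract_deriv_def using b by (intro the_equality) blast+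
qed

lemma fract_deriv_to_fract:
  assumes D: "derivation_over scale D"
  shows "fract_deriv D (to_fract b) = to_fract (D b)"
proof -
  have "D 1 = 0" by (rule derivation_over_1[OF D])
  thus ?thesis using fract_deriv_Fract[OF D, of 1 b] by (simp add: to_fract_def)
qed

lemma comm_algebra_fract_scale:
  assumes "comm_algebra scale"
  shows "comm_algebra (fract_scale scale)"
proof -
  interpret comm_algebra scale by fact
  have "scale (c * d) 1 = scale c 1 * scale d 1" for c d
    using scale_mult_left[of c 1 "scale d 1"] by simp
  thus ?thesis
    by unfold_locales (simp_all add: fract_scale_def algebra_simps scale_left_distrib)
qed

lemma derivation_fract_deriv:
  assumes alg: "comm_algebra scale" and D: "derivation_over scale D"
  shows "derivation_over (fract_scale scale) (fract_deriv D)"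
proof -
  interpret comm_algebra scale by fact
  interpret K: comm_algebra "fract_scale scale" by (rule comm_algebra_fract_scale) fact
  have D1: "D 1 = 0" by (rule derivation_over_1[OF D])
  have add: "fract_deriv D (x + y) = fract_deriv D x + fract_deriv D y" for x y
    by (cases x; cases y)
      (simp add: fract_deriv_Fract[OF D] derivation_overD[OF D] eq_fract algebra_simps)
  have mult: "fract_deriv D (x * y) = fract_deriv D x * y + x * fract_deriv D y" for x y
    by (cases x; cases y)
      (simp add: fract_deriv_Fract[OF D] derivation_overD[OF D] eq_fract algebra_simps)
  have const: "fract_deriv D (to_fract (scale c 1)) = 0" for c
    by (simp add: fract_deriv_to_fract[OF D] derivation_overD(2)[OF D] D1)
  have sc: "fract_deriv D (fract_scale scale c x) = fract_scale scale c (fract_deriv D x)" for c x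
    by (simp add: fract_scale_def mult const)
  have "Vector_Spaces.linear (fract_scale scale) (fract_scale scale) (fract_deriv D)"
    by unfold_locales (rule add, rule sc)
  with mult show ?thesis by (simp add: derivation_over_def)
qed

lemma fract_deriv_unique:
  fixes scale :: "'k::field \<Rightarrow> 'b::idom \<Rightarrow> 'b"
  assumes D: "derivation_over scale D"
    and E: "derivation_over (fract_scale scale) E"
    and ext: "\<And>b. E (to_fract b) = to_fract (D b)"
  shows "E = fract_deriv D"
proof
  fix q :: "'b fract"
  obtain a b where q: "q = Fract a b" and b: "b \<noteq> 0" by (cases q)
  have q': "to_fract a = q * to_fract b" using b by (simp add: q to_fract_def eq_fract)
  from arg_cong[OF q', of E] have "to_fract (D a) = E q * to_fract b + q * to_fract (D b)"
    by (simp add: ext derivation_overD(3)[OF E])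
  hence "E q * to_fract b = to_fract (D a) - q * to_fract (D b)" by simp
  also have "\<dots> = fract_deriv D q * to_fract b"
    using b by (simp add: q fract_deriv_Fract[OF D] to_fract_def eq_fract algebra_simps)
  finally show "E q = fract_deriv D q" using b by simp
qed

end

theory Submission
  imports Defs
begin

text \<open>Let \<open>F\<close> be the field generated over \<open>k\<close> by the \<open>b\<^sub>i s^(-l\<^sub>i)\<close>. These elements are killed by
  \<open>D\<close>, and \<open>b\<^sub>i \<in> F(s)\<close>, so \<open>F \<subseteq> ker D\<close> and \<open>K = F(s)\<close>. Since \<open>D s = s\<close> and the characteristic
  is zero, the powers of \<open>s\<close> are linearly independent over \<open>ker D\<close>: apply \<open>D\<close> to an algebraic
  relation of minimal degree. If \<open>f = p(s) / q(s)\<close> with \<open>p, q \<in> F[X]\<close> is in \<open>ker D\<close>, then comparing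
  coefficients in \<open>f q(s) = p(s)\<close> gives \<open>f \<in> F\<close>.\<close>

section \<open>Subfields\<close>

lemma is_subfieldD:
  assumes "is_subfield S"
  shows "0 \<in> S" "1 \<in> S" "x \<in> S \<Longrightarrow> y \<in> S \<Longrightarrow> x + y \<in> S" "x \<in> S \<Longrightarrow> y \<in> S \<Longrightarrow> x * y \<in> S"
    "x \<in> S \<Longrightarrow> - x \<in> S" "x \<in> S \<Longrightarrow> inverse x \<in> S"
  using assms by (auto simp: is_subfield_def)

lemma is_subfield_sum:
  assumes "is_subfield S" "\<And>i. i \<in> A \<Longrightarrow> f i \<in> S"
  shows "sum f A \<in> S"
  using assms(2) by (induction A rule: infinite_finite_induct)
    (auto intro: is_subfieldD[OF assms(1)])

lemma is_subfield_power:
  assumes "is_subfield S" "x \<in> S"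
  shows "x ^ n \<in> S"
  by (induction n) (auto intro: is_subfieldD[OF assms(1)] assms(2))

lemma is_subfield_power_int:
  assumes "is_subfield S" "x \<in> S"
  shows "x powi n \<in> S"
  by (auto simp: power_int_def intro!: is_subfield_power is_subfieldD[OF assms(1)] assms)

lemma is_subfield_field_adjoin: "is_subfield (field_adjoin F U)"
  unfolding field_adjoin_def by (rule hull_in) (auto simp: is_subfield_def)

lemma field_adjoin_superset: "F \<union> U \<subseteq> field_adjoin F U"
  unfolding field_adjoin_def by (rule hull_subset)

lemma field_adjoin_least: "F \<subseteq> S \<Longrightarrow> U \<subseteq> S \<Longrightarrow> is_subfield S \<Longrightarrow> field_adjoin F U \<subseteq> S"
  unfolding field_adjoin_def by (rule hull_minimal) auto

lemma coeff_mult_in_subfield: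
  assumes "is_subfield F" "\<And>i. coeff p i \<in> F" "\<And>i. coeff q i \<in> F"
  shows "coeff (p * q) i \<in> F"
  unfolding coeff_mult
  by (intro is_subfield_sum[OF assms(1)] is_subfieldD(4)[OF assms(1)] assms(2,3))

text \<open>The quotients \<open>poly p s / poly q s\<close> with coefficients in \<open>F\<close>
  already form a subfield \<open>T\<close> containing \<open>F\<close> and \<open>s\<close>, so
  minimality of the adjunction puts \<open>f\<close> in \<open>T\<close>.\<close>

lemma field_adjoin_singleton:
  fixes F :: "'f::field set"
  assumes F: "is_subfield F" and f: "f \<in> field_adjoin F {s}"
  obtains p q where "\<And>i. coeff p i \<in> F" "\<And>i. coeff q i \<in> F" "poly q s \<noteq> 0"
    "f = poly p s / poly q s"
proof -
  note closed = is_subfieldD[OF F]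
  define R where "R = {p. \<forall>i. coeff p i \<in> F}"
  have R1: "1 \<in> R" and R0: "0 \<in> R" and RX: "[:0, 1:] \<in> R"
    by (auto simp: R_def coeff_pCons closed split: nat.splits)
  have Rc: "[:c:] \<in> R" if "c \<in> F" for c
    using that by (auto simp: R_def coeff_pCons closed split: nat.splits)
  have Radd: "p + q \<in> R" and Rmult: "p * q \<in> R" and Rminus: "- p \<in> R"
    if "p \<in> R" "q \<in> R" for p q
    using that by (auto simp: R_def closed coeff_mult_in_subfield[OF F])
  define T where "T = {poly p s / poly q s | p q. p \<in> R \<and> q \<in> R \<and> poly q s \<noteq> 0}"
  have TI: "x \<in> T" if "p \<in> R" "q \<in> R" "poly q s \<noteq> 0" "x = poly p s / poly q s" for x p q
    using that by (auto simp: T_def)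
  have "is_subfield T"
    unfolding is_subfield_def
  proof (intro conjI ballI)
    show "0 \<in> T" by (rule TI[OF R0 R1]) auto
    show "1 \<in> T" by (rule TI[OF R1 R1]) auto
  next
    fix x y assume "x \<in> T" "y \<in> T"
    then obtain p q p' q' where
      R: "p \<in> R" "q \<in> R" "p' \<in> R" "q' \<in> R" and nz: "poly q s \<noteq> 0" "poly q' s \<noteq> 0"
      and xy: "x = poly p s / poly q s" "y = poly p' s / poly q' s"
      by (auto simp: T_def)
    show "x + y \<in> T"
      by (rule TI[of "p * q' + p' * q" "q * q'"]) (use R nz in \<open>auto simp: xy field_simps intro: Radd Rmult\<close>)
    show "x * y \<in> T"
      by (rule TI[of "p * p'" "q * q'"]) (use R nz in \<open>auto simp: xy intro: Rmult\<close>)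
  next
    fix x assume "x \<in> T"
    then obtain p q where R: "p \<in> R" "q \<in> R" and nz: "poly q s \<noteq> 0"
      and x: "x = poly p s / poly q s"
      by (auto simp: T_def)
    show "- x \<in> T"
      by (rule TI[of "- p" q]) (use R nz in \<open>auto simp: x intro: Rminus\<close>)
    show "inverse x \<in> T"
    proof (cases "poly p s = 0")
      \<comment> \<open>Here \<open>x = 0\<close>, and \<open>inverse 0 = 0\<close> is represented
        by \<open>0 / 1\<close>; swapping numerator and denominator would divide by zero.\<close>
      case True
      then show ?thesis by (intro TI[OF R0 R1]) (auto simp: x)
    next
      case False
      then show ?thesis by (intro TI[OF R(2,1)]) (auto simp: x)
    qed
  qed
  moreover have "F \<subseteq> T" by (auto intro!: TI[OF Rc R1])
  moreover have "{s} \<subseteq> T" by (auto intro!: TI[OF RX R1])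
  ultimately have "f \<in> T" using field_adjoin_least f by blast
  then show ?thesis using that by (auto simp: T_def R_def)
qed

section \<open>Derivations of a field\<close>

text \<open>Equality can fail in positive characteristic, and the locale below works over an
  arbitrary field.\<close>

lemma degree_pderiv_le: "degree (pderiv p) \<le> degree p - 1"
  by (rule degree_le) (auto simp: coeff_pderiv coeff_eq_0)

text \<open>Scalars do not appear: the linearity that matters below is over the kernel, and it
  follows from the Leibniz rule.\<close>

locale field_derivation =
  fixes D :: "'f::field \<Rightarrow> 'f"
  assumes add: "D (x + y) = D x + D y"
    and mult: "D (x * y) = D x * y + x * D y"
begin

lemma zero [simp]: "D 0 = 0"
  using add[of 0 0] by (simp only: add_0_right add_cancel_right_right)

lemma one [simp]: "D 1 = 0"
  using mult[of 1 1] by (simp only: mult_1_left mult_1_right add_cancel_right_right)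

lemma minus: "D (- x) = - D x"
  using add[of x "- x"] by (simp add: eq_neg_iff_add_eq_0 add.commute)

lemma inverse:
  assumes "x \<noteq> 0"
  shows "D (inverse x) = - D x * inverse x * inverse x"
proof -
  have "D x * inverse x + x * D (inverse x) = 0"
    using mult[of x "inverse x"] assms by simp
  then have "x * D (inverse x) = - D x * inverse x"
    by (simp add: eq_neg_iff_add_eq_0 add.commute)
  then have "inverse x * (x * D (inverse x)) = - D x * inverse x * inverse x"
    by simp
  then show ?thesis using assms by (simp flip: mult.assoc)
qed

lemma sum: "D (sum g A) = (\<Sum>i\<in>A. D (g i))"
  by (induction A rule: infinite_finite_induct) (auto simp: add)

lemma is_subfield_kernel: "is_subfield {f. D f = 0}"
proof -
  have "D (inverse x) = 0" if "D x = 0" for x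
    using inverse[of x] that by (cases "x = 0") auto
  then show ?thesis by (simp add: is_subfield_def add mult minus)
qed

lemma power:
  assumes "D s = s"
  shows "D (s ^ n) = of_nat n * s ^ n"
  by (induction n) (auto simp: mult assms algebra_simps)

lemma power_int:
  assumes "D s = s"
  shows "D (s powi m) = of_int m * s powi m"
proof (cases "s = 0")
  \<comment> \<open>\<open>0 powi m\<close> is 1 for \<open>m = 0\<close> and 0 otherwise, so both
    sides vanish.\<close>
  case True
  then show ?thesis by (simp add: power_int_0_left_if)
next
  case False
  show ?thesis
  proof (cases "m \<ge> 0")
    case True
    then show ?thesis by (simp add: power_int_def power[OF assms])
  next
    case neg: False
    have "s powi m = inverse (s ^ nat (- m))"
      using neg by (simp add: power_int_def power_inverse)
    then show ?thesis
      using False neg inverse[of "s ^ nat (- m)"]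
      by (simp add: power[OF assms])
  qed
qed

text \<open>Eigenvalues add under multiplication, and \<open>s powi (- m)\<close> has eigenvalue
  \<open>- m\<close>.\<close>

lemma eigenvector_normalized:
  assumes s: "D s = s" "s \<noteq> 0" and x: "D x = of_int m * x"
  shows "D (x * s powi (- m)) = 0"
  by (simp add: mult x power_int[OF s(1)])

text \<open>This says that \<open>s\<close> is transcendental over the kernel. Applying
  \<open>D\<close> to \<open>poly p s = 0\<close> gives \<open>s * poly (pderiv p) s = 0\<close>, a
  relation of smaller degree, so induction yields \<open>pderiv p = 0\<close>.\<close>

lemma poly_eq_0_imp_coeff_eq_0:
  assumes char0: "\<And>n. n > 0 \<Longrightarrow> of_nat n \<noteq> (0::'f)"
    and s: "D s = s" "s \<noteq> 0"
    and "\<And>i. D (coeff p i) = 0" "poly p s = 0"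
  shows "p = 0"
  using assms(4,5)
proof (induction "degree p" arbitrary: p rule: less_induct)
  case less
  show ?case
  proof (cases "degree p = 0")
    case True
    then obtain c where "p = [:c:]" by (rule degree_eq_zeroE)
    then show ?thesis using less.prems by simp
  next
    case False
    have "0 = D (poly p s)" using less.prems by simp
    also have "\<dots> = (\<Sum>i\<le>degree p. coeff p i * (of_nat i * s ^ i))"
      by (simp add: poly_altdef sum mult power[OF s(1)] less.prems)
    also have "\<dots> = s * poly (pderiv p) s"
    proof -
      obtain d where d: "degree p = Suc d" using False not0_implies_Suc by blast
      \<comment> \<open>The sum for \<open>pderiv p\<close> may stop before \<open>d\<close>; it is
        padded with zero coefficients. The shift then drops the term \<open>i = 0\<close>, whose
        factor \<open>of_nat i\<close> is 0.\<close>
      have "degree (pderiv p) \<le> d" using degree_pderiv_le[of p] d by simp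
      then have "poly (pderiv p) s = (\<Sum>i\<le>d. coeff (pderiv p) i * s ^ i)"
        by (auto simp: poly_altdef intro!: le_degree intro!: sum.mono_neutral_left)
      then show ?thesis
        unfolding d by (subst sum.atMost_Suc_shift)
          (simp add: coeff_pderiv sum_distrib_left algebra_simps)
    qed
    finally have "poly (pderiv p) s = 0" using s by simp
    moreover have "D (of_nat n) = 0" for n
      by (induction n) (auto simp: add)
    then have "D (coeff (pderiv p) i) = 0" for i
      by (simp add: coeff_pderiv mult less.prems add)
    moreover have "degree (pderiv p) < degree p"
      using degree_pderiv_le[of p] False by simp
    ultimately have "pderiv p = 0" by (intro less.hyps)
    \<comment> \<open>This product is the coefficient of \<open>pderiv p\<close> at
      \<open>degree p - 1\<close>; by \<open>char0\<close> it vanishes only if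
      \<open>lead_coeff p\<close> does.\<close>
    then have "of_nat (degree p) * lead_coeff p = 0"
      using False coeff_pderiv[of p "degree p - 1"] by simp
    then show ?thesis using char0 False by auto
  qed
qed

lemma kernel_adjoin_subset:
  assumes char0: "\<And>n. n > 0 \<Longrightarrow> of_nat n \<noteq> (0::'f)"
    and s: "D s = s" "s \<noteq> 0"
    and F: "is_subfield F" "F \<subseteq> {f. D f = 0}"
    and f: "f \<in> field_adjoin F {s}" "D f = 0"
  shows "f \<in> F"
proof -
  obtain p q where pq: "\<And>i. coeff p i \<in> F" "\<And>i. coeff q i \<in> F"
    and nz: "poly q s \<noteq> 0" and eq: "f = poly p s / poly q s"
    using field_adjoin_singleton[OF F(1) f(1)] by metis
  have ker: "D (coeff p i) = 0" "D (coeff q i) = 0" for i using pq F(2) by auto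
  \<comment> \<open>The coefficients need not be known to lie in \<open>F\<close>: they lie in the
    kernel because \<open>f\<close> does, which is enough for independence.\<close>
  have "smult f q - p = 0"
  proof (rule poly_eq_0_imp_coeff_eq_0[OF char0 s])
    show "D (coeff (smult f q - p) i) = 0" for i
      using ker add[of "f * coeff q i" "- coeff p i"] f(2) by (simp add: mult minus)
    show "poly (smult f q - p) s = 0" using nz by (simp add: eq)
  qed
  \<comment> \<open>Any index where \<open>q\<close> has a nonzero coefficient would do; the leading
    one is nonzero since \<open>poly q s\<close> is.\<close>
  then have "f * lead_coeff q = coeff p (degree q)" by (metis coeff_smult right_minus_eq)
  moreover have "lead_coeff q \<noteq> 0" using nz by auto
  ultimately have "f = coeff p (degree q) * inverse (lead_coeff q)"
    by (simp add: field_simps)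
  then show ?thesis using pq is_subfieldD[OF F(1)] by simp
qed

end

section \<open>Characteristic zero in the fraction field, and the kernel of
  \<open>fract_deriv D\<close>\<close>

lemma of_nat_fract_neq_0:
  fixes scale :: "'k::field_char_0 \<Rightarrow> 'b::idom \<Rightarrow> 'b"
  assumes "comm_algebra scale" "n > 0"
  shows "of_nat n \<noteq> (0 :: 'b fract)"
proof -
  interpret comm_algebra scale by fact
  have "scale (of_nat n) 1 = of_nat n"
    by (induction n) (simp_all add: scale_left_distrib)
  \<comment> \<open>Since \<open>1\<close> is nonzero in the domain, \<open>scale c 1\<close>
    vanishes only for \<open>c = 0\<close>; this carries characteristic zero from the base field to
    the domain.\<close>
  moreover have "scale (of_nat n) 1 \<noteq> 0" using assms(2) by simp
  ultimately have "of_nat n \<noteq> (0 :: 'b)" by simp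
  moreover have "of_nat n = to_fract (of_nat n :: 'b)"
    by (induction n) simp_all
  ultimately show ?thesis by simp
qed

theorem theorem4p2:
  fixes scale :: "'k::{alg_closed_field, field_char_0} \<Rightarrow> 'b::idom \<Rightarrow> 'b"
    and D :: "'b \<Rightarrow> 'b"
    and s :: "'b fract"
    and n :: nat
    and b :: "nat \<Rightarrow> 'b fract"
    and l :: "nat \<Rightarrow> int"
  assumes "comm_algebra scale"
    and "fin_gen_algebra scale"
    and "derivation_over scale D"
    and "semisimple scale D"
    and "eigenvalues scale D \<subseteq> \<int>"
    and "s \<noteq> 0"
    and "fract_deriv D s = s"
    and "field_adjoin (base_field scale) (b ` {1..n}) = UNIV"
    and "\<And>i. i \<in> {1..n} \<Longrightarrow> fract_deriv D (b i) = of_int (l i) * b i"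
  shows "{f. fract_deriv D f = 0}
           = field_adjoin (base_field scale) ((\<lambda>i. b i * s powi (- l i)) ` {1..n})
         \<and> field_adjoin {f. fract_deriv D f = 0} {s} = UNIV"
proof -
  interpret field_derivation "fract_deriv D"
    using derivation_overD[OF derivation_fract_deriv[OF assms(1,3)]] by unfold_locales
  let ?u = "\<lambda>i. b i * s powi (- l i)"
  let ?ker = "{f. fract_deriv D f = 0}"
  define F where "F = field_adjoin (base_field scale) (?u ` {1..n})"
  have F: "is_subfield F" unfolding F_def by (rule is_subfield_field_adjoin)
  have gens: "base_field scale \<union> ?u ` {1..n} \<subseteq> F"
    unfolding F_def by (rule field_adjoin_superset)
  interpret B: comm_algebra scale by fact
  have "base_field scale \<subseteq> ?ker"
    by (auto simp: base_field_def fract_deriv_to_fract[OF assms(3)]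
        derivation_overD(2)[OF assms(3)] derivation_over_1[OF assms(3)])
  moreover have "?u ` {1..n} \<subseteq> ?ker"
    using assms(9) eigenvector_normalized[OF assms(7,6)] by auto
  ultimately have F_ker: "F \<subseteq> ?ker"
    unfolding F_def by (rule field_adjoin_least) (rule is_subfield_kernel)
  have Fs: "field_adjoin F {s} = UNIV"
  proof -
    let ?L = "field_adjoin F {s}"
    have L: "is_subfield ?L" by (rule is_subfield_field_adjoin)
    have sub: "F \<subseteq> ?L" "s \<in> ?L" using field_adjoin_superset[of F "{s}"] by auto
    have "b i \<in> ?L" if "i \<in> {1..n}" for i
    proof -
      have "?u i \<in> ?L" using gens sub that by blast
      then have "?u i * s powi l i \<in> ?L"
        by (rule is_subfieldD(4)[OF L]) (rule is_subfield_power_int[OF L sub(2)])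
      also have "?u i * s powi l i = b i"
        using assms(6) by (simp add: power_int_minus)
      finally show ?thesis .
    qed
    \<comment> \<open>\<open>?L\<close> contains the base field and every \<open>b i\<close>, which
      together generate the whole fraction field.\<close>
    then show ?thesis
      using field_adjoin_least[of "base_field scale" ?L "b ` {1..n}"] gens sub L assms(8) by blast
  qed
  \<comment> \<open>By \<open>Fs\<close>, every kernel element lies in
    \<open>field_adjoin F {s}\<close>, as \<open>kernel_adjoin_subset\<close> requires.\<close>
  have "?ker \<subseteq> F"
    using kernel_adjoin_subset[OF of_nat_fract_neq_0[OF assms(1)] assms(7,6) F F_ker] Fs by auto
  then have ker: "?ker = F" using F_ker by blast
  show ?thesis using ker Fs by (simp add: F_def)
qed

end
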